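(* \[ \lim_{n\to\infty} \frac{\gamma^*_e(\mathcal{K}_n)}{n^2} \le \frac{1}{23}. \]
   Context: For vertices $u,v$ of a graph $G$, $\dist(u,v)$ is the length of a shortest $uv$ path and $w^*(u,v) = 2^{1-\dist(u,v)}$. A set $D \subseteq V(G)$ is a porous exponential dominating set if $\sum_{d \in D} w^*(d,v) \ge 1$ for every $v \in V(G)$; the porous exponential domination number $\gamma^*_e(G)$ is the minimum cardinality of such a set. The King grid is $\mathcal{K}_n = P_n \boxtimes P_n$, the strong product of two paths on $n$ vertices: vertex set $[n]\times[n]$, with two distinct vertices $(a,b),(c,d)$ adjacent iff $|a-c|\le 1$ and $|b-d| \le 1$. *)

theory Defs
  imports Complex_Main "HOL-Library.Extended_Nat" "Graph_Theory.Pair_Digraph"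
begin

text \<open>
  A finite simple graph is a \<^typ>\<open>'a pair_pre_digraph\<close> satisfying \<^locale>\<open>pair_graph\<close>:
  the arc relation is symmetric and irreflexive, and each edge is represented by its two
  orientations.

  The distance is \<infinity> if there is no path, because an infimum over the empty set
  in \<^typ>\<open>enat\<close> is \<infinity>.
\<close>

definition graph_dist :: "'a pair_pre_digraph \<Rightarrow> 'a \<Rightarrow> 'a \<Rightarrow> enat" where
  "graph_dist G u v = (INF p \<in> {p. pre_digraph.apath (with_proj G) u p v}. enat (length p))"

definition porous_weight :: "'a pair_pre_digraph \<Rightarrow> 'a \<Rightarrow> 'a \<Rightarrow> real" where
  "porous_weight G u v =
     (case graph_dist G u v of enat d \<Rightarrow> 2 powi (1 - int d) | \<infinity> \<Rightarrow> 0)"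

definition porous_exp_dominating :: "'a pair_pre_digraph \<Rightarrow> 'a set \<Rightarrow> bool" where
  "porous_exp_dominating G D \<longleftrightarrow>
     D \<subseteq> pverts G \<and> (\<forall>v \<in> pverts G. (\<Sum>d\<in>D. porous_weight G d v) \<ge> 1)"

text \<open>
  Meaningful for finite \<^term>\<open>G\<close> only; there the whole vertex set is dominating, so
  the minimum is attained.
\<close>

definition porous_exp_domination_number :: "'a pair_pre_digraph \<Rightarrow> nat" where
  "porous_exp_domination_number G = (LEAST k. \<exists>D. porous_exp_dominating G D \<and> card D = k)"

definition path_graph :: "nat \<Rightarrow> nat pair_pre_digraph" where
  "path_graph n =
     \<lparr> pverts = {1..n},
       parcs = {(i, j). i \<in> {1..n} \<and> j \<in> {1..n} \<and> (j = i + 1 \<or> i = j + 1)} \<rparr>"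

definition strong_product ::
    "'a pair_pre_digraph \<Rightarrow> 'b pair_pre_digraph \<Rightarrow> ('a \<times> 'b) pair_pre_digraph" where
  "strong_product G H =
     \<lparr> pverts = pverts G \<times> pverts H,
       parcs = {((a, b), (c, d)).
         (a, b) \<in> pverts G \<times> pverts H \<and> (c, d) \<in> pverts G \<times> pverts H \<and>
         (a, b) \<noteq> (c, d) \<and>
         (a = c \<or> (a, c) \<in> parcs G) \<and> (b = d \<or> (b, d) \<in> parcs H)} \<rparr>"

definition king_grid :: "nat \<Rightarrow> (nat \<times> nat) pair_pre_digraph" where
  "king_grid n = strong_product (path_graph n) (path_graph n)"

lemma pverts_king_grid: "pverts (king_grid n) = {1..n} \<times> {1..n}"
  by (simp add: king_grid_def strong_product_def path_graph_def)

lemma parcs_king_grid: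
  "((a, b), (c, d)) \<in> parcs (king_grid n) \<longleftrightarrow>
     (a, b) \<in> {1..n} \<times> {1..n} \<and> (c, d) \<in> {1..n} \<times> {1..n} \<and> (a, b) \<noteq> (c, d) \<and>
     \<bar>int a - int c\<bar> \<le> 1 \<and> \<bar>int b - int d\<bar> \<le> 1"
  unfolding king_grid_def strong_product_def path_graph_def by simp linarith

lemma pair_graph_king_grid: "pair_graph (king_grid n)"
proof -
  have sub: "parcs (king_grid n) \<subseteq> pverts (king_grid n) \<times> pverts (king_grid n)"
    by (auto simp: king_grid_def strong_product_def)
  have fin: "finite (pverts (king_grid n))"
    by (simp add: pverts_king_grid)
  have "finite (parcs (king_grid n))"
    by (rule finite_subset[OF sub]) (simp add: fin)
  moreover have "sym (parcs (king_grid n))"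
    by (rule symI) (auto simp: parcs_king_grid abs_minus_commute)
  moreover have "fst e \<noteq> snd e" if "e \<in> parcs (king_grid n)" for e
    using that by (cases e) (auto simp: king_grid_def strong_product_def)
  ultimately show ?thesis
    using sub fin by unfold_locales (auto simp: symmetric_def)
qed

end

theory Submission
  imports Defs
begin

text \<open>
  The distance in the king grid is the Chebyshev distance, so an optimal dominating set of the
  grid of side \<open>n\<close> can be copied into each square of side \<open>n\<close> of a larger grid. As in Fekete's
  lemma, the density therefore converges to its infimum. All vertices near the boundary together
  with the lattice \<open>23 dvd x + 4 * y\<close> form a dominating set of density \<open>1 / 23\<close>: for each residue
  of \<open>x + 4 * y\<close>, the lattice points within distance 4 already have total weight at least 1.
\<close>

section \<open>Distances in the king grid\<close>

definition chebyshev :: "nat \<times> nat \<Rightarrow> nat \<times> nat \<Rightarrow> nat" where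
  "chebyshev u v = nat (max \<bar>int (fst u) - int (fst v)\<bar> \<bar>int (snd u) - int (snd v)\<bar>)"

lemma of_nat_chebyshev:
  "int (chebyshev u v) = max \<bar>int (fst u) - int (fst v)\<bar> \<bar>int (snd u) - int (snd v)\<bar>"
  by (simp add: chebyshev_def le_max_iff_disj)

lemma chebyshev_le_iff:
  "chebyshev u v \<le> k \<longleftrightarrow>
     \<bar>int (fst u) - int (fst v)\<bar> \<le> int k \<and> \<bar>int (snd u) - int (snd v)\<bar> \<le> int k"
  by (simp add: chebyshev_def nat_le_iff)

lemma king_grid_arc_iff:
  "(u, v) \<in> parcs (king_grid n) \<longleftrightarrow>
     u \<in> pverts (king_grid n) \<and> v \<in> pverts (king_grid n) \<and> u \<noteq> v \<and> chebyshev u v \<le> 1"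
  by (cases u; cases v) (auto simp: parcs_king_grid pverts_king_grid chebyshev_le_iff)

lemma wf_digraph_king_grid: "wf_digraph (with_proj (king_grid n))"
  unfolding wf_digraph_wp_iff by unfold_locales (auto simp: king_grid_def strong_product_def)

text \<open>An arc changes each coordinate by at most 1, so the triangle inequality gives this lower
  bound on the distance.\<close>

lemma awalk_king_grid_chebyshev_le:
  assumes "pre_digraph.awalk (with_proj (king_grid n)) u p v"
  shows "chebyshev u v \<le> length p"
  using assms
proof (induction p arbitrary: u)
  case Nil
  then show ?case
    by (simp add: wf_digraph.awalk_Nil_iff[OF wf_digraph_king_grid] chebyshev_def)
next
  case (Cons e p)
  then have e: "e \<in> parcs (king_grid n)" "fst e = u"
    and p: "pre_digraph.awalk (with_proj (king_grid n)) (snd e) p v"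
    by (auto simp: wf_digraph.awalk_Cons_iff[OF wf_digraph_king_grid])
  have "chebyshev u (snd e) \<le> 1"
    using e by (metis king_grid_arc_iff prod.collapse)
  then show ?case
    using Cons.IH[OF p] by (simp add: chebyshev_le_iff abs_le_iff)
qed

text \<open>A king moving greedily lowers both nonzero coordinate gaps at once, so each move lowers
  their maximum by exactly 1.\<close>

lemma king_grid_apath_exists:
  assumes "u \<in> pverts (king_grid n)" "v \<in> pverts (king_grid n)"
  shows "\<exists>p. pre_digraph.apath (with_proj (king_grid n)) u p v \<and> length p = chebyshev u v"
  using assms(1)
proof (induction "chebyshev u v" arbitrary: u)
  case 0
  then have "u = v"
    by (auto simp: chebyshev_def prod_eq_iff)
  then show ?case
    using 0 by (intro exI[of _ "[]"]) (auto simp: wf_digraph.apath_Nil_iff[OF wf_digraph_king_grid])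
next
  case (Suc k)
  \<comment> \<open>\<open>s a b\<close> is \<open>a\<close> moved one unit towards
    \<open>b\<close>, or left in place if they agree.\<close>
  define s :: "nat \<Rightarrow> nat \<Rightarrow> nat" where
    "s a b = (if a < b then a + 1 else if b < a then a - 1 else a)" for a b
  define w where "w = (s (fst u) (fst v), s (snd u) (snd v))"
  have bds: "fst u \<in> {1..n}" "snd u \<in> {1..n}" "fst v \<in> {1..n}" "snd v \<in> {1..n}"
    using Suc.prems assms(2) by (auto simp: pverts_king_grid)
  have "\<bar>int (s a b) - int b\<bar> = max 0 (\<bar>int a - int b\<bar> - 1)" for a b
    by (auto simp: s_def)
  then have "int (chebyshev w v) = max 0 (int (chebyshev u v) - 1)"
    by (simp add: of_nat_chebyshev w_def max_diff_distrib_left ac_simps)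
  then have w: "chebyshev w v = k"
    using Suc.hyps(2)[symmetric] by simp
  have "s a b \<in> {1..n}" if "a \<in> {1..n}" "b \<in> {1..n}" for a b
    using that by (auto simp: s_def)
  then have wv: "w \<in> pverts (king_grid n)"
    using bds by (simp add: pverts_king_grid w_def)
  have "u \<noteq> w"
    using w Suc.hyps(2) by auto
  moreover have "chebyshev u w \<le> 1"
    by (simp add: chebyshev_le_iff w_def s_def)
  ultimately have arc: "(u, w) \<in> parcs (king_grid n)"
    using Suc.prems wv by (simp add: king_grid_arc_iff)
  obtain p where p: "pre_digraph.apath (with_proj (king_grid n)) w p v" "length p = k"
    using Suc.hyps(1)[of w] w wv by auto
  \<comment> \<open>An \<open>apath\<close> repeats no vertex. If the tail returned to
    \<open>u\<close>, its remainder \<open>r\<close> would be a walk to \<open>v\<close> of length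
    at most \<open>k\<close>, but the Chebyshev distance of \<open>u\<close> and \<open>v\<close> is
    \<open>Suc k\<close>.\<close>
  have "u \<notin> set (pre_digraph.awalk_verts (with_proj (king_grid n)) w p)"
  proof
    assume "u \<in> set (pre_digraph.awalk_verts (with_proj (king_grid n)) w p)"
    moreover have "pre_digraph.awalk (with_proj (king_grid n)) w p v"
      using p(1) by (simp only: pre_digraph.apath_def)
    ultimately obtain q r where "p = q @ r"
      "pre_digraph.awalk (with_proj (king_grid n)) u r v"
      using wf_digraph.awalk_decomp[OF wf_digraph_king_grid] by metis
    then show False
      using awalk_king_grid_chebyshev_le[of n u r v] p(2) Suc.hyps(2) by auto
  qed
  then have "pre_digraph.apath (with_proj (king_grid n)) u ((u, w) # p) v"
    using p arc by (simp add: wf_digraph.apath_Cons_iff[OF wf_digraph_king_grid])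
  then show ?case
    using p(2) Suc.hyps(2) by (metis length_Cons)
qed

lemma graph_dist_king_grid:
  assumes "u \<in> pverts (king_grid n)" "v \<in> pverts (king_grid n)"
  shows "graph_dist (king_grid n) u v = enat (chebyshev u v)"
  unfolding graph_dist_def
proof (rule antisym)
  show "(INF p \<in> {p. pre_digraph.apath (with_proj (king_grid n)) u p v}. enat (length p))
      \<le> enat (chebyshev u v)"
    using king_grid_apath_exists[OF assms] by (auto intro: INF_lower2)
  show "enat (chebyshev u v)
      \<le> (INF p \<in> {p. pre_digraph.apath (with_proj (king_grid n)) u p v}. enat (length p))"
    by (rule INF_greatest)
      (auto simp: pre_digraph.apath_def intro: awalk_king_grid_chebyshev_le)
qed

section \<open>Porous weights and dominating sets of the king grid\<close>

lemma porous_weight_king_grid: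
  assumes "u \<in> pverts (king_grid n)" "v \<in> pverts (king_grid n)"
  shows "porous_weight (king_grid n) u v = 2 powi (1 - int (chebyshev u v))"
  by (simp add: porous_weight_def graph_dist_king_grid[OF assms])

lemma porous_weight_nonneg: "0 \<le> porous_weight G u v"
  by (auto simp: porous_weight_def split: enat.splits)

lemma finite_pverts_king_grid: "finite (pverts (king_grid n))"
  by (simp add: pverts_king_grid)

text \<open>Weights are nonnegative, so for each vertex it suffices to exhibit a part
  \<open>A\<close> of \<open>D\<close> that already contributes 1: a single vertex, one translated
  copy, or a local window.\<close>

lemma porous_exp_dominating_king_gridI:
  assumes "D \<subseteq> pverts (king_grid n)"
    and "\<And>v. v \<in> pverts (king_grid n) \<Longrightarrow>
      \<exists>A\<subseteq>D. 1 \<le> (\<Sum>d\<in>A. 2 powi (1 - int (chebyshev d v)) :: real)"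
  shows "porous_exp_dominating (king_grid n) D"
  unfolding porous_exp_dominating_def
proof (intro conjI ballI assms(1))
  fix v assume v: "v \<in> pverts (king_grid n)"
  obtain A where A: "A \<subseteq> D" "1 \<le> (\<Sum>d\<in>A. 2 powi (1 - int (chebyshev d v)) :: real)"
    using assms(2)[OF v] by blast
  note A(2)
  also have "(\<Sum>d\<in>A. 2 powi (1 - int (chebyshev d v)) :: real)
      = (\<Sum>d\<in>A. porous_weight (king_grid n) d v)"
    by (rule sum.cong) (use A(1) assms(1) v in \<open>auto simp: porous_weight_king_grid\<close>)
  also have "\<dots> \<le> (\<Sum>d\<in>D. porous_weight (king_grid n) d v)"
    by (rule sum_mono2)
      (use A(1) assms(1) finite_pverts_king_grid in \<open>auto intro: finite_subset porous_weight_nonneg\<close>)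
  finally show "1 \<le> (\<Sum>d\<in>D. porous_weight (king_grid n) d v)" .
qed

lemma porous_exp_domination_number_le_card:
  "porous_exp_dominating G D \<Longrightarrow> porous_exp_domination_number G \<le> card D"
  unfolding porous_exp_domination_number_def by (blast intro: Least_le)

lemma porous_exp_domination_number_king_grid_attained:
  obtains D where "porous_exp_dominating (king_grid n) D"
    "card D = porous_exp_domination_number (king_grid n)"
proof -
  \<comment> \<open>Every vertex receives weight 2 from itself, so the whole vertex set dominates
    and \<open>LEAST\<close> ranges over a nonempty set.\<close>
  have "porous_exp_dominating (king_grid n) (pverts (king_grid n))"
    by (rule porous_exp_dominating_king_gridI)
      (auto intro!: exI[of _ "{_}"] simp: chebyshev_def)
  then have "\<exists>k D. porous_exp_dominating (king_grid n) D \<and> card D = k"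
    by blast
  from LeastI_ex[OF this] show ?thesis
    unfolding porous_exp_domination_number_def[symmetric] using that by blast
qed

section \<open>Existence of the limit\<close>

text \<open>The large grid is covered by translates of the small one, the last ones in each direction
  shifted back so as to fit; the king distance inside a translate agrees with that of the
  large grid.\<close>

lemma porous_exp_domination_number_king_grid_tiling:
  assumes "0 < n" "n \<le> m"
  shows "porous_exp_domination_number (king_grid m)
    \<le> (m div n + 1)\<^sup>2 * porous_exp_domination_number (king_grid n)"
proof -
  obtain D where D: "porous_exp_dominating (king_grid n) D"
    and card_D: "card D = porous_exp_domination_number (king_grid n)"
    by (rule porous_exp_domination_number_king_grid_attained)
  have D_sub: "D \<subseteq> {1..n} \<times> {1..n}"
    using D by (simp add: porous_exp_dominating_def pverts_king_grid)
  define t where "t i = min (i * n) (m - n)" for i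
  define f :: "nat \<Rightarrow> nat \<Rightarrow> nat \<times> nat \<Rightarrow> nat \<times> nat"
    where "f i j d = (fst d + t i, snd d + t j)" for i j d
  define I where "I = {0..m div n}"
  define E where "E = (\<Union>(i, j) \<in> I \<times> I. f i j ` D)"
  have cover: "\<exists>i\<in>I. \<exists>a\<in>{1..n}. x = a + t i" if "x \<in> {1..m}" for x
  proof (intro bexI)
    \<comment> \<open>Coordinates start at 1, hence the shift before the division. If the offset is
      cut down to \<open>m - n\<close>, the upper bound on \<open>x - t ?i\<close> comes from
      \<open>x \<le> m\<close> instead of from the remainder.\<close>
    let ?i = "(x - 1) div n"
    have eq: "?i * n + (x - 1) mod n = x - 1"
      by simp
    have lt: "(x - 1) mod n < n"
      using assms(1) by simp
    have ge: "t ?i \<le> ?i * n" "t ?i \<le> m - n" "t ?i = ?i * n \<or> t ?i = m - n"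
      by (auto simp: t_def min_def)
    show "x - t ?i \<in> {1..n}"
      unfolding atLeastAtMost_iff using eq lt ge that[unfolded atLeastAtMost_iff] assms(2) by linarith
    show "x = x - t ?i + t ?i"
      using eq ge that[unfolded atLeastAtMost_iff] by linarith
    show "?i \<in> I"
      using that by (auto simp: I_def intro: div_le_mono)
  qed
  have "porous_exp_dominating (king_grid m) E"
  proof (rule porous_exp_dominating_king_gridI)
    have "a + t i \<in> {1..m}" if "a \<in> {1..n}" for a i
      using that assms by (auto simp: t_def min_def)
    then show "E \<subseteq> pverts (king_grid m)"
      using D_sub by (force simp: E_def f_def pverts_king_grid)
  next
    fix v assume "v \<in> pverts (king_grid m)"
    then obtain i j a b where ij: "i \<in> I" "j \<in> I" and ab: "a \<in> {1..n}" "b \<in> {1..n}"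
      and v: "v = (a + t i, b + t j)"
      using cover[of "fst v"] cover[of "snd v"] by (auto simp: pverts_king_grid)
    have "1 \<le> (\<Sum>d\<in>D. porous_weight (king_grid n) d (a, b))"
      using D ab by (simp add: porous_exp_dominating_def pverts_king_grid)
    also have "\<dots> = (\<Sum>d\<in>D. 2 powi (1 - int (chebyshev d (a, b))))"
      by (rule sum.cong)
        (use D_sub ab in \<open>auto simp: porous_weight_king_grid pverts_king_grid subset_iff\<close>)
    also have "\<dots> = (\<Sum>d\<in>D. 2 powi (1 - int (chebyshev (f i j d) v)))"
      by (simp add: f_def chebyshev_def v)
    also have "\<dots> = (\<Sum>d\<in>f i j ` D. 2 powi (1 - int (chebyshev d v)))"
      by (rule sum.reindex_cong[OF _ refl refl, symmetric]) (auto simp: inj_on_def f_def)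
    finally show "\<exists>A\<subseteq>E. 1 \<le> (\<Sum>d\<in>A. 2 powi (1 - int (chebyshev d v)) :: real)"
      using ij by (intro exI[of _ "f i j ` D"]) (auto simp: E_def)
  qed
  then have "porous_exp_domination_number (king_grid m) \<le> card E"
    by (rule porous_exp_domination_number_le_card)
  \<comment> \<open>Translates that were shifted back may overlap; the union bound absorbs
    this.\<close>
  also have "card E \<le> (\<Sum>(i, j) \<in> I \<times> I. card (f i j ` D))"
    unfolding E_def by (rule order.trans[OF card_UN_le]) (auto simp: I_def case_prod_unfold)
  also have "\<dots> \<le> (\<Sum>(i, j) \<in> I \<times> I. card D)"
    by (rule sum_mono)
      (use D_sub in \<open>auto intro!: card_image_le intro: finite_subset\<close>)
  also have "\<dots> = (m div n + 1)\<^sup>2 * card D"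
    by (simp add: I_def case_prod_unfold power2_eq_square)
  finally show ?thesis
    by (simp add: card_D)
qed

text \<open>Every density is at least the infimum. Conversely, given a fixed \<open>n\<close> whose
  density is below \<open>a\<close>, tiling bounds the density at \<open>m\<close> by that density
  times \<open>(1 + n / m)\<^sup>2\<close>, and this factor tends to 1.\<close>

lemma convergent_if_almost_homogeneous:
  fixes f :: "nat \<Rightarrow> real"
  assumes nonneg: "\<And>n. 0 \<le> f n"
    and tiling: "\<And>m n. 0 < n \<Longrightarrow> n \<le> m \<Longrightarrow> f m \<le> (real (m div n + 1))\<^sup>2 * f n"
  shows "convergent (\<lambda>n. f n / (real n)\<^sup>2)"
proof -
  \<comment> \<open>At 0 the quotient is 0 by the convention on division by zero, which would force
    the infimum to be 0.\<close>
  define L where "L = (INF n\<in>{0<..}. f n / (real n)\<^sup>2)"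
  have bdd: "bdd_below ((\<lambda>n. f n / (real n)\<^sup>2) ` {0<..})"
    using nonneg by (intro bdd_belowI2[of _ 0]) auto
  have "(\<lambda>n. f n / (real n)\<^sup>2) \<longlonglongrightarrow> L"
  proof (rule order_tendstoI)
    fix a assume "a < L"
    then show "\<forall>\<^sub>F n in sequentially. a < f n / (real n)\<^sup>2"
      by (intro eventually_mono[OF eventually_gt_at_top[of 0]])
        (auto simp: L_def intro: less_le_trans[OF _ cINF_lower[OF bdd]])
  next
    fix a assume "L < a"
    then obtain n where n: "0 < n" "f n / (real n)\<^sup>2 < a"
      unfolding L_def using cINF_less_iff[OF _ bdd] by auto
    have "(\<lambda>m. (1 + real n / real m)\<^sup>2 * (f n / (real n)\<^sup>2)) \<longlonglongrightarrow> (1 + 0)\<^sup>2 * (f n / (real n)\<^sup>2)"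
      by (intro tendsto_intros lim_const_over_n)
    then have "\<forall>\<^sub>F m in sequentially. (1 + real n / real m)\<^sup>2 * (f n / (real n)\<^sup>2) < a"
      using n by (intro order_tendstoD) auto
    then show "\<forall>\<^sub>F m in sequentially. f m / (real m)\<^sup>2 < a"
      using eventually_ge_at_top[of n]
    proof eventually_elim
      case (elim m)
      have "real (m div n + 1) \<le> real m / real n + 1"
        using of_nat_div_le_of_nat[of m n] by simp
      then have "(real (m div n + 1))\<^sup>2 * f n \<le> (real m / real n + 1)\<^sup>2 * f n"
        by (intro mult_right_mono power_mono nonneg) simp_all
      with tiling[OF n(1) elim(2)] have "f m \<le> (real m / real n + 1)\<^sup>2 * f n"
        by (rule order_trans)
      then have "f m / (real m)\<^sup>2 \<le> (real m / real n + 1)\<^sup>2 * f n / (real m)\<^sup>2"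
        by (rule divide_right_mono) simp
      also have "\<dots> = (1 + real n / real m)\<^sup>2 * (f n / (real n)\<^sup>2)"
        using n elim(2) by (simp add: field_simps power2_eq_square)
      finally show ?case
        using elim(1) by simp
    qed
  qed
  then show ?thesis
    by (rule convergentI)
qed

section \<open>The lattice construction and its density\<close>

text \<open>Distinct members of one residue class lie in distinct blocks of 23 consecutive numbers,
  and the block indices run from 0 to \<open>n div 23\<close>.\<close>

lemma card_residue_class_le:
  fixes c :: int
  shows "card {x \<in> {1..n}. 23 dvd int x + c} \<le> n div 23 + 1"
proof -
  have "inj_on (\<lambda>x. x div 23) {x \<in> {1..n}. 23 dvd int x + c}"
  proof (rule inj_onI, clarify)
    fix x y assume "23 dvd int x + c" "23 dvd int y + c" and div: "x div 23 = y div 23"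
    then have "23 dvd int x - int y"
      by (metis add_diff_cancel_right dvd_diff)
    then have "int (x mod 23) = int (y mod 23)"
      by (simp add: zmod_int mod_eq_dvd_iff)
    then have "x mod 23 = y mod 23"
      by (rule of_nat_eq_iff[THEN iffD1])
    with div show "x = y"
      by (metis div_mult_mod_eq)
  qed
  then have "card {x \<in> {1..n}. 23 dvd int x + c} \<le> card {0..n div 23}"
    by (rule card_inj_on_le) (auto intro: div_le_mono)
  then show ?thesis
    by simp
qed

text \<open>The weight that a vertex \<open>(x, y)\<close> with \<open>x + 4 * y = r\<close>
  receives from the lattice points within distance 4; \<open>w\<close> is the displacement from the
  vertex to such a point.\<close>

definition window_weight :: "int \<Rightarrow> real" where
  "window_weight r = (\<Sum>w \<in> {w \<in> {-4..4} \<times> {-4..4}. 23 dvd r + fst w + 4 * snd w}.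
     2 powi (1 - max \<bar>fst w\<bar> \<bar>snd w\<bar>))"

text \<open>Four border strips of width 4 cost at most \<open>16 * n\<close> vertices and dominate
  themselves. Every other vertex has its whole radius 4 window inside the grid, so the window bound
  applies to it. The lattice has at most \<open>n div 23 + 1\<close> points for each
  \<open>y\<close>.\<close>

lemma porous_exp_domination_number_king_grid_le:
  assumes "\<And>r. 1 \<le> window_weight r"
  shows "porous_exp_domination_number (king_grid n) \<le> n * (n div 23 + 1) + 16 * n"
proof -
  \<comment> \<open>\<open>y\<close> comes first so that the fibres are the residue classes counted
    above; \<open>prod.swap\<close> in \<open>D\<close> restores the order.\<close>
  define P where "P = (SIGMA y:{1..n}. {x \<in> {1..n}. 23 dvd int x + 4 * int y})"
  \<comment> \<open>For small \<open>n\<close> the truncated \<open>n-3\<close> is 0; the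
    intersection removes this value and anything above \<open>n\<close>.\<close>
  define B where "B = ({1..4} \<union> {n-3..n}) \<inter> {1..n}"
  define D where "D = prod.swap ` P \<union> (B \<times> {1..n} \<union> {1..n} \<times> B)"
  have "porous_exp_dominating (king_grid n) D"
  proof (rule porous_exp_dominating_king_gridI)
    show "D \<subseteq> pverts (king_grid n)"
      by (auto simp: D_def P_def B_def pverts_king_grid)
  next
    fix v assume "v \<in> pverts (king_grid n)"
    then obtain x y where v: "v = (x, y)" and xy: "x \<in> {1..n}" "y \<in> {1..n}"
      by (auto simp: pverts_king_grid)
    show "\<exists>A\<subseteq>D. 1 \<le> (\<Sum>d\<in>A. 2 powi (1 - int (chebyshev d v)) :: real)"
    proof (cases "x \<in> B \<or> y \<in> B")
      case True
      then have "v \<in> D"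
        using xy by (auto simp: D_def v)
      then show ?thesis
        by (intro exI[of _ "{v}"]) (auto simp: chebyshev_def)
    next
      case False
      then have in_range: "x \<in> {5..n-4}" "y \<in> {5..n-4}"
        using xy by (auto simp: B_def)
      define W :: "(int \<times> int) set"
        where "W = {w \<in> {-4..4} \<times> {-4..4}. 23 dvd (int x + 4 * int y) + fst w + 4 * snd w}"
      \<comment> \<open>\<open>g\<close> carries displacements to grid vertices. On \<open>W\<close>
        both arguments of \<open>nat\<close> are positive, which makes \<open>g\<close> injective
        there.\<close>
      define g where "g = (\<lambda>(i, j). (nat (int x + i), nat (int y + j)))"
      have W: "\<bar>fst w\<bar> \<le> 4" "\<bar>snd w\<bar> \<le> 4"
        "0 < int x + fst w" "0 < int y + snd w" "int x + fst w \<le> int n" "int y + snd w \<le> int n"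
        "23 dvd (int x + 4 * int y) + fst w + 4 * snd w"
        if "w \<in> W" for w
        using that in_range by (auto simp: W_def)
      have sub: "g ` W \<subseteq> D"
      proof (rule image_subsetI)
        fix w assume w: "w \<in> W"
        have "nat (int x + fst w) \<in> {1..n}" "nat (int y + snd w) \<in> {1..n}"
          using W(3-6)[OF w] by (simp_all add: Suc_le_eq nat_le_iff)
        moreover have "23 dvd int (nat (int x + fst w)) + 4 * int (nat (int y + snd w))"
          using W(3,4,7)[OF w] by (simp add: algebra_simps)
        ultimately have "prod.swap (g w) \<in> P"
          by (simp add: P_def g_def case_prod_unfold)
        then show "g w \<in> D"
          by (auto simp: D_def image_iff intro!: bexI[of _ "prod.swap (g w)"])
      qed
      have inj: "inj_on g W"
      proof (rule inj_onI)
        fix w w' assume "w \<in> W" "w' \<in> W" "g w = g w'"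
        then show "w = w'"
          using W(3,4)[of w] W(3,4)[of w'] by (auto simp: g_def case_prod_unfold prod_eq_iff)
      qed
      have "int (chebyshev (g w) v) = max \<bar>fst w\<bar> \<bar>snd w\<bar>" if "w \<in> W" for w
        using W(3,4)[OF that] by (simp add: of_nat_chebyshev g_def v case_prod_unfold)
      then have "window_weight (int x + 4 * int y) = (\<Sum>w\<in>W. 2 powi (1 - int (chebyshev (g w) v)))"
        unfolding window_weight_def W_def[symmetric] by (intro sum.cong) simp_all
      with assms have "1 \<le> (\<Sum>w\<in>W. 2 powi (1 - int (chebyshev (g w) v)) :: real)"
        by metis
      also have "\<dots> = (\<Sum>d\<in>g ` W. 2 powi (1 - int (chebyshev d v)))"
        by (simp add: sum.reindex[OF inj])
      finally show ?thesis
        using sub by blast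
    qed
  qed
  then have "porous_exp_domination_number (king_grid n) \<le> card D"
    by (rule porous_exp_domination_number_le_card)
  also have "card D \<le> card P + (card B * n + n * card B)"
    unfolding D_def
    by (intro order.trans[OF card_Un_le] add_mono card_image_le)
      (auto simp: P_def card_cartesian_product)
  finally have le: "porous_exp_domination_number (king_grid n) \<le> card P + 2 * n * card B"
    by (simp add: algebra_simps)
  have "card P = (\<Sum>y\<in>{1..n}. card {x \<in> {1..n}. 23 dvd int x + 4 * int y})"
    unfolding P_def by (rule card_SigmaI) auto
  also have "\<dots> \<le> (\<Sum>y\<in>{1..n}. n div 23 + 1)"
    by (intro sum_mono card_residue_class_le)
  finally have card_P: "card P \<le> n * (n div 23 + 1)"
    by simp
  have "card B \<le> card ({1..4} \<union> {n-3..n})"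
    unfolding B_def by (rule card_mono) auto
  also have "\<dots> \<le> card {1..4::nat} + card {n-3..n}"
    by (rule card_Un_le)
  also have "\<dots> \<le> 8"
    by simp
  finally have "2 * n * card B \<le> 2 * n * 8"
    by (rule mult_le_mono2)
  with le card_P show ?thesis
    by linarith
qed

text \<open>Explicit integer ranges with an \<open>if\<close> can be unfolded by the simplifier,
  which then decides each divisibility.\<close>

lemma window_weight_eq_nested_sum:
  "window_weight r = (\<Sum>i\<in>{-4..4}. \<Sum>j\<in>{-4..4}.
     if 23 dvd r + i + 4 * j then 2 powi (1 - max \<bar>i\<bar> \<bar>j\<bar>) else 0)"
  unfolding window_weight_def
  by (subst sum.inter_filter) (simp_all add: sum.cartesian_product case_prod_unfold)

\<comment> \<open>The simplifier computes the 23 values and instantiates \<open>?weights\<close>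
  with them.\<close>
schematic_goal window_weight_table:
  "map window_weight [0..22] = ?weights"
  by (simp add: window_weight_eq_nested_sum upto_rec1 power_int_minus flip: set_upto)

text \<open>The window weight depends only on \<open>r\<close> modulo 23, so the table covers all
  cases.\<close>

lemma window_weight_ge_1: "1 \<le> window_weight r"
proof -
  have "r mod 23 \<in> set [0..22]"
    by simp
  moreover have "\<forall>x\<in>set (map window_weight [0..22]). 1 \<le> x"
    unfolding window_weight_table by simp
  ultimately have "1 \<le> window_weight (r mod 23)"
    by simp
  moreover have "23 dvd r mod 23 + i + 4 * j \<longleftrightarrow> 23 dvd r + i + 4 * j" for i j
    by (metis (no_types) add.assoc dvd_eq_mod_eq_0 mod_add_left_eq)
  ultimately show ?thesis
    by (simp add: window_weight_def)
qed

theorem theorem3p2: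
  shows "\<exists>L::real.
    (\<lambda>n. real (porous_exp_domination_number (king_grid n)) / (real n)\<^sup>2) \<longlonglongrightarrow> L \<and> L \<le> 1 / 23"
proof -
  let ?g = "\<lambda>n. real (porous_exp_domination_number (king_grid n))"
  have "convergent (\<lambda>n. ?g n / (real n)\<^sup>2)"
  proof (rule convergent_if_almost_homogeneous)
    fix m n :: nat assume "0 < n" "n \<le> m"
    then show "?g m \<le> (real (m div n + 1))\<^sup>2 * ?g n"
      using porous_exp_domination_number_king_grid_tiling[of n m]
      by (metis of_nat_le_iff of_nat_mult of_nat_power)
  qed simp
  then obtain L where L: "(\<lambda>n. ?g n / (real n)\<^sup>2) \<longlonglongrightarrow> L"
    by (auto simp: convergent_def)
  \<comment> \<open>The 17 is 16 from the border strips plus 1 from rounding up the number of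
    lattice points for each \<open>y\<close>.\<close>
  have lim: "(\<lambda>n. 1 / 23 + 17 / real n) \<longlonglongrightarrow> 1 / 23 + 0"
    by (intro tendsto_intros lim_const_over_n)
  have "?g n / (real n)\<^sup>2 \<le> 1 / 23 + 17 / real n" if "1 \<le> n" for n
  proof -
    have "?g n \<le> real (n * (n div 23 + 1) + 16 * n)"
      using porous_exp_domination_number_king_grid_le[OF window_weight_ge_1, of n] by (simp only: of_nat_le_iff)
    also have "\<dots> = real n * (real (n div 23) + 17)"
      by (simp add: algebra_simps)
    also have "\<dots> \<le> real n * (real n / 23 + 17)"
      using of_nat_div_le_of_nat[of n 23] by (intro mult_left_mono) auto
    finally show ?thesis
      using that by (simp add: field_simps power2_eq_square)
  qed
  then have "L \<le> 1 / 23 + 0"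
    by (intro LIMSEQ_le[OF L lim]) blast
  with L show ?thesis
    by auto
qed

end
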